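(* Let $(P,\preceq,\wedge,\vee,\hat 0)$ be a locally finite lattice with least element $\hat 0$, let $f:P\to\mathbb{C}$ be semimultiplicative with $f(x)\neq 0$ for all $x\in P$, and put $g(x)=1/f(x)$. Let $S=\{x_1,\ldots,x_n\}$ be a finite lower closed subset of $P$ such that $x_i\preceq x_j$ only if $i\leq j$, and suppose $l_i:=\Delta_i(g)\neq 0$ for all $i\in\{1,\ldots,n\}$. Call $\lambda\in\mathbb{C}$ admissible if $(S)_fx=\lambda[S]_fx$ for some $x\in\mathbb{C}^n\setminus\{0\}$. (i) Every admissible $\lambda$ lies in one of the disks \[ \Big\{z\in\mathbb{C}:\Big|z-l_i^{-1}\sum_{\alpha,\beta=1}^n\frac{\mu(x_\alpha,x_i)\mu(x_\beta,x_i)}{f(x_\alpha\vee x_\beta)}\Big|\leq|l_i|^{-1}\sum_{\substack{1\leq j\leq n\\ j\neq i}}\Big|\sum_{\alpha,\beta=1}^n\frac{\mu(x_\alpha,x_i)\mu(x_\beta,x_j)}{f(x_\alpha\vee x_\beta)}\Big|\Big\},\quad i\in\{1,\ldots,n\}. \] (ii) Every admissible $\lambda$ satisfies $|\lambda|\leq c_f^{-1}m_g^{-1}F_{n+1}(F_{n+3}-2)$, where $c_f=\min_{1\le i,j\le n}|f(x_i\vee x_j)|$, $m_g=\min_{1\le i\le n}|\Delta_i(g)|$, and $(F_k)$ is the Fibonacci sequence $F_1=F_2=1$, $F_{k+2}=F_k+F_{k+1}$.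
   Context: Incidence functions of $P$ are functions $h:P\times P\to\mathbb{C}$ with $h(x,y)=0$ whenever $x\not\preceq y$; convolution $(h*k)(x,y)=\sum_{x\preceq z\preceq y}h(x,z)k(z,y)$. The Möbius function $\mu$: $\mu(x,x)=1$, $\mu(x,y)=-\sum_{x\preceq z\prec y}\mu(x,z)$ for $x\prec y$, $\mu(x,y)=0$ if $x\not\preceq y$. For $h:P\to\mathbb{C}$, $h_d$ is an incidence function with $h_d(\hat 0,z)=h(z)$, so $(h_d*\mu)(\hat 0,z)=\sum_{w\preceq z}h(w)\mu(w,z)$. $\Delta_i(h)=\sum(h_d*\mu)(\hat 0,z)$ over all $z\in P$ with $z\preceq x_i$ and $z\not\preceq x_j$ for every $j<i$. Meet matrix $(S)_f$: $(i,j)$ entry $f(x_i\wedge x_j)$; join matrix $[S]_f$: $(i,j)$ entry $f(x_i\vee x_j)$. $S$ is lower closed if $y\in S$ whenever $x\in S$, $y\in P$, $y\preceq x$. $f$ is semimultiplicative if $f(x\wedge y)f(x\vee y)=f(x)f(y)$ for all $x,y$. *)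

theory Defs
  imports Jordan_Normal_Form.Matrix "HOL-Number_Theory.Fib"
begin

text \<open>A family \<open>x\<^sub>1, \<dots>, x\<^sub>n\<close> of elements is represented by the values \<open>x 0, \<dots>, x (n - 1)\<close> of a
  function on \<open>nat\<close>, in line with the \<open>0\<close>-based indices of vectors and matrices.\<close>

definition locally_finite :: "'a::order itself \<Rightarrow> bool" where
  "locally_finite _ \<longleftrightarrow> (\<forall>x y :: 'a. finite {x..y})"

definition incidence_function :: "('a::order \<Rightarrow> 'a \<Rightarrow> complex) \<Rightarrow> bool" where
  "incidence_function h \<longleftrightarrow> (\<forall>x y. \<not> x \<le> y \<longrightarrow> h x y = 0)"

definition convolution ::
    "('a::order \<Rightarrow> 'a \<Rightarrow> complex) \<Rightarrow> ('a \<Rightarrow> 'a \<Rightarrow> complex) \<Rightarrow> 'a \<Rightarrow> 'a \<Rightarrow> complex" where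
  "convolution h k x y = (\<Sum>z\<in>{x..y}. h x z * k z y)"

text \<open>The guard \<open>finite {x..y}\<close> only serves to make the recursion terminate on every order; it is
  vacuous on locally finite ones, see \<open>moebius_less\<close> below.\<close>

function moebius :: "'a::order \<Rightarrow> 'a \<Rightarrow> complex" where
  "moebius x y =
    (if x = y then 1
     else if x < y \<and> finite {x..y} then - (\<Sum>z\<in>{x..<y}. moebius x z)
     else 0)"
  by pat_completeness auto
termination
proof (relation "measure (\<lambda>(x, y). card {x..y})", goal_cases)
  case 1
  show ?case by simp
next
  case (2 x y z)
  then have fin: "finite {x..y}" and z: "x \<le> z" "z < y" and "x < y" by auto
  have "{x..z} \<subseteq> {x..y}" "y \<in> {x..y}" "y \<notin> {x..z}"
    using z \<open>x < y\<close> by (auto simp: less_le_not_le)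
  then have "{x..z} \<subset> {x..y}" by blast
  then show ?case using fin by (simp add: psubset_card_mono)
qed

declare moebius.simps [simp del]

lemma moebius_refl [simp]: "moebius x x = 1"
  by (simp add: moebius.simps)

lemma moebius_less:
  fixes x y :: "'a::order"
  assumes "locally_finite TYPE('a)" "x < y"
  shows "moebius x y = - (\<Sum>z\<in>{x..<y}. moebius x z)"
  using assms by (subst moebius.simps) (auto simp: locally_finite_def)

lemma moebius_not_le: "\<not> x \<le> y \<Longrightarrow> moebius x y = 0"
  by (subst moebius.simps) (auto simp: less_le)

lemma incidence_function_moebius: "incidence_function moebius"
  by (simp add: incidence_function_def moebius_not_le)

text \<open>\<open>incidence_of h\<close> is one incidence function \<open>h\<^sub>d\<close> with \<open>h\<^sub>d(bot, z) = h(z)\<close>. Its values at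
  \<open>(x, z)\<close> for \<open>x \<noteq> bot\<close> are irrelevant for \<open>(h\<^sub>d * \<mu>)(bot, z)\<close>, see \<open>convolution_bot_cong\<close>.\<close>

definition incidence_of :: "('a::order_bot \<Rightarrow> complex) \<Rightarrow> 'a \<Rightarrow> 'a \<Rightarrow> complex" where
  "incidence_of h x z = (if x = bot then h z else 0)"

lemma incidence_function_incidence_of: "incidence_function (incidence_of h)"
  by (auto simp: incidence_function_def incidence_of_def)

lemma convolution_bot_cong:
  assumes "\<And>z. h\<^sub>d bot z = h z"
  shows "convolution h\<^sub>d k bot z = convolution (incidence_of h) k bot z"
  using assms by (simp add: convolution_def incidence_of_def)

lemma convolution_incidence_of_moebius:
  "convolution (incidence_of h) moebius bot z = (\<Sum>w\<in>{..z}. h w * moebius w z)"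
proof -
  have "{bot..z} = {..z}" by auto
  then show ?thesis by (simp add: convolution_def incidence_of_def)
qed

definition Delta :: "(nat \<Rightarrow> 'a::order_bot) \<Rightarrow> nat \<Rightarrow> ('a \<Rightarrow> complex) \<Rightarrow> complex" where
  "Delta x i h =
    (\<Sum>z\<in>{z. z \<le> x i \<and> (\<forall>j<i. \<not> z \<le> x j)}. convolution (incidence_of h) moebius bot z)"

definition meet_matrix :: "nat \<Rightarrow> (nat \<Rightarrow> 'a::lattice) \<Rightarrow> ('a \<Rightarrow> complex) \<Rightarrow> complex mat" where
  "meet_matrix n x f = mat n n (\<lambda>(i, j). f (inf (x i) (x j)))"

definition join_matrix :: "nat \<Rightarrow> (nat \<Rightarrow> 'a::lattice) \<Rightarrow> ('a \<Rightarrow> complex) \<Rightarrow> complex mat" where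
  "join_matrix n x f = mat n n (\<lambda>(i, j). f (sup (x i) (x j)))"

definition lower_closed :: "'a::order set \<Rightarrow> bool" where
  "lower_closed S \<longleftrightarrow> (\<forall>x\<in>S. \<forall>y. y \<le> x \<longrightarrow> y \<in> S)"

definition semimultiplicative :: "('a::lattice \<Rightarrow> complex) \<Rightarrow> bool" where
  "semimultiplicative f \<longleftrightarrow> (\<forall>x y. f (inf x y) * f (sup x y) = f x * f y)"

definition admissible :: "nat \<Rightarrow> (nat \<Rightarrow> 'a::lattice) \<Rightarrow> ('a \<Rightarrow> complex) \<Rightarrow> complex \<Rightarrow> bool" where
  "admissible n x f lam \<longleftrightarrow>
    (\<exists>v \<in> carrier_vec n. v \<noteq> 0\<^sub>v n \<and>
      meet_matrix n x f *\<^sub>v v = lam \<cdot>\<^sub>v (join_matrix n x f *\<^sub>v v))"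

end

theory Submission
  imports Defs Jordan_Normal_Form.Determinant
begin

text \<open>Semimultiplicativity turns the pencil of the meet and join matrices of \<open>f\<close> into that of the
  join and meet matrices of \<open>g = 1 / f\<close>, after scaling the eigenvector by \<open>f (x j)\<close>. As \<open>S\<close> is lower
  closed, the meet matrix of \<open>g\<close> factors as \<open>Z\<^sup>T L Z\<close> with the zeta matrix \<open>Z\<close> of \<open>S\<close> and
  \<open>L\<close> the diagonal matrix of the \<open>Delta x i g\<close>. Hence \<open>lam\<close> is an eigenvalue of \<open>L\<^sup>-\<^sup>1 B\<close>, where
  \<open>B\<close> is the join matrix of \<open>g\<close> transformed by \<open>M = Z\<^sup>-\<^sup>1\<close>, and (i) is Gershgorin's theorem. For (ii),
  the columns of \<open>M\<close>, the inverse of a unitriangular \<open>0\<close>-\<open>1\<close> matrix, have Fibonacci bounds on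
  their absolute sums.\<close>

section \<open>Matrix inverses, Gershgorin's theorem and Fibonacci sums\<close>

lemma fun_inverse_commute:
  fixes A B :: "nat \<Rightarrow> nat \<Rightarrow> 'a::field"
  assumes "\<And>i j. i < n \<Longrightarrow> j < n \<Longrightarrow> (\<Sum>k<n. A i k * B k j) = of_bool (i = j)"
    and "i < n" "j < n"
  shows "(\<Sum>k<n. B i k * A k j) = of_bool (i = j)"
proof -
  let ?A = "mat n n (\<lambda>(i, j). A i j)" and ?B = "mat n n (\<lambda>(i, j). B i j)"
  have mult: "(mat n n (\<lambda>(i, j). C i j) * mat n n (\<lambda>(i, j). D i j)) $$ (i, j) = (\<Sum>k<n. C i k * D k j)"
    if "i < n" "j < n" for i j and C D :: "nat \<Rightarrow> nat \<Rightarrow> 'a"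
    using that by (simp add: scalar_prod_def atLeast0LessThan)
  have "?A * ?B = 1\<^sub>m n"
    using assms(1) by (intro eq_matI) (simp_all add: mult del: index_mult_mat(1))
  then have "?B * ?A = 1\<^sub>m n"
    by (rule mat_mult_left_right_inverse[rotated 2]) auto
  then show ?thesis
    using mult[OF assms(2,3), of B A] assms(2,3) by (auto simp del: index_mult_mat(1))
qed

text \<open>Row \<open>p\<close> of \<open>B u = lam L u\<close> is read at a coordinate
  \<open>u p\<close> of maximal modulus. The form not divided by \<open>l p\<close> serves both the
  disks and the bound on \<open>lam\<close>.\<close>

lemma Gershgorin:
  fixes B :: "nat \<Rightarrow> nat \<Rightarrow> complex"
  assumes eq: "\<And>p. p < n \<Longrightarrow> (\<Sum>k<n. B p k * u k) = lam * l p * u p"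
    and nz: "\<exists>k<n. u k \<noteq> 0"
  obtains p where "p < n" "cmod (lam * l p - B p p) \<le> (\<Sum>k\<in>{..<n} - {p}. cmod (B p k))"
proof -
  define m where "m = Max ((\<lambda>k. cmod (u k)) ` {..<n})"
  have le: "cmod (u k) \<le> m" if "k < n" for k
    using that by (auto simp: m_def)
  have "m \<in> (\<lambda>k. cmod (u k)) ` {..<n}"
    unfolding m_def using nz by (intro Max_in) auto
  then obtain p where p: "p < n" "cmod (u p) = m" by auto
  have "m > 0"
    using nz le by (metis less_le_trans zero_less_norm_iff)
  have "lam * l p * u p = B p p * u p + (\<Sum>k\<in>{..<n} - {p}. B p k * u k)"
    using eq[OF p(1)] p(1) by (simp add: sum.remove[of "{..<n}" p])
  then have "(lam * l p - B p p) * u p = (\<Sum>k\<in>{..<n} - {p}. B p k * u k)"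
    by (simp add: algebra_simps)
  then have "cmod (lam * l p - B p p) * m = cmod (\<Sum>k\<in>{..<n} - {p}. B p k * u k)"
    by (metis norm_mult p(2))
  also have "\<dots> \<le> (\<Sum>k\<in>{..<n} - {p}. cmod (B p k) * m)"
    by (intro sum_norm_le) (auto simp: norm_mult intro!: mult_left_mono le)
  also have "\<dots> = (\<Sum>k\<in>{..<n} - {p}. cmod (B p k)) * m"
    by (simp add: sum_distrib_right)
  finally show ?thesis
    using \<open>m > 0\<close> p(1) that by simp
qed

text \<open>The next term of the recursion lies between minus the sum of the positive parts and the sum
  of the negative parts of the earlier terms; the larger of these two sums and their total grow
  like consecutive Fibonacci numbers.\<close>

lemma sum_abs_le_fib:
  fixes b :: "nat \<Rightarrow> real"
  assumes "\<bar>b 0\<bar> \<le> 1"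
    and rec: "\<And>k. 0 < k \<Longrightarrow> k < m \<Longrightarrow> b k = - (\<Sum>j<k. c k j * b j)"
    and c: "\<And>k j. 0 \<le> c k j \<and> c k j \<le> 1"
    and "0 < m"
  shows "(\<Sum>j<m. \<bar>b j\<bar>) \<le> real (fib (m + 1))"
proof -
  define P where "P k = (\<Sum>j<k. max 0 (b j))" for k
  define N where "N k = (\<Sum>j<k. max 0 (- b j))" for k
  have bounds: "b k \<le> N k \<and> - b k \<le> P k" if k: "0 < k" "k < m" for k
  proof -
    have "- (c k j * b j) \<le> max 0 (- b j)" "c k j * b j \<le> max 0 (b j)" for j
      using c[of k j] mult_left_le_one_le[of "b j" "c k j"] mult_left_le_one_le[of "- b j" "c k j"]
        mult_nonneg_nonneg[of "c k j" "b j"] mult_nonneg_nonneg[of "c k j" "- b j"]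
      by (cases "b j \<ge> 0"; simp add: max_def)+
    then have "(\<Sum>j<k. - (c k j * b j)) \<le> N k" "(\<Sum>j<k. c k j * b j) \<le> P k"
      unfolding P_def N_def by (intro sum_mono; simp)+
    then show ?thesis
      by (simp add: rec[OF k] sum_negf)
  qed
  have "P k \<le> fib k \<and> N k \<le> fib k \<and> P k + N k \<le> fib (k + 1)" if "1 \<le> k" "k \<le> m" for k
    using that
  proof (induction k rule: dec_induct)
    case base
    then show ?case using assms(1) by (auto simp: P_def N_def max_def)
  next
    \<comment> \<open>If \<open>b k >= 0\<close>, then \<open>P\<close> grows by at most
      \<open>N k\<close>, hence to at most \<open>fib (k + 1)\<close>, while \<open>N\<close> stays
      and the total grows by at most \<open>fib k\<close>. The other sign exchanges \<open>P\<close>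
      and \<open>N\<close>.\<close>
    case (step k)
    moreover have "b k \<le> N k" "- b k \<le> P k"
      using bounds[of k] step by auto
    moreover have "P (Suc k) = P k + max 0 (b k)" "N (Suc k) = N k + max 0 (- b k)"
      by (simp_all add: P_def N_def)
    moreover have "0 \<le> P k" "0 \<le> N k"
      by (auto simp: P_def N_def intro!: sum_nonneg)
    ultimately show ?case
      by (auto simp: max_def)
  qed
  moreover have "(\<Sum>j<m. \<bar>b j\<bar>) = P m + N m"
    unfolding P_def N_def sum.distrib[symmetric] by (intro sum.cong) (auto simp: max_def)
  ultimately show ?thesis using \<open>0 < m\<close> by simp
qed

text \<open>The identity \<open>F_1 + ... + F_(n+1) = F_(n+3) - 1\<close> with \<open>F_1\<close>
  left out, whence the constant 2.\<close>

lemma sum_fib: "(\<Sum>i<n. real (fib (i + 2))) = real (fib (n + 3)) - 2"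
  by (induction n) (auto simp: numeral_eq_Suc)

section \<open>The Moebius function on a lower closed family\<close>

lemma sum_moebius:
  fixes x y :: "'a::order"
  assumes "locally_finite TYPE('a)"
  shows "(\<Sum>z\<in>{x..y}. moebius x z) = of_bool (x = y)"
proof (cases "x < y")
  case True
  then have "{x..y} = insert y {x..<y}"
    by (auto simp: le_less)
  moreover have "finite {x..<y}"
    by (rule finite_subset[of _ "{x..y}"]) (use assms in \<open>auto simp: locally_finite_def\<close>)
  ultimately show ?thesis
    using True moebius_less[OF assms True] by auto
next
  case False
  then show ?thesis
    by (cases "x = y") (auto simp: less_le)
qed

text \<open>The split into positive and negative parts in \<open>sum_abs_le_fib\<close> requires
  real entries.\<close>

lemma moebius_in_Reals: "moebius x y \<in> \<real>"
proof (induction x y rule: moebius.induct)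
  case (1 x y)
  then show ?case
    by (subst moebius.simps) (auto intro!: sum_in_Reals)
qed

locale lower_closed_family =
  fixes x :: "nat \<Rightarrow> 'a::order" and n :: nat
  assumes locally_finite: "locally_finite TYPE('a)"
    and lower_closed: "lower_closed (x ` {..<n})"
    and mono: "\<And>i j. i < n \<Longrightarrow> j < n \<Longrightarrow> x i \<le> x j \<Longrightarrow> i \<le> j"
begin

lemma inj: "inj_on x {..<n}"
  by (intro inj_onI antisym mono) auto

lemma below_family:
  assumes "i < n" "z \<le> x i"
  obtains k where "k < n" "z = x k"
  using lower_closed assms unfolding lower_closed_def by blast

text \<open>No element below \<open>x j\<close> leaves the family, so sums over intervals and ideals
  of the whole order become sums over indices. This lets \<open>moebius\<close> be treated as an n
  by n matrix.\<close>

lemma sum_below: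
  fixes F :: "'a \<Rightarrow> complex"
  assumes "j < n" "\<And>z. z \<in> A \<Longrightarrow> z \<le> x j"
  shows "(\<Sum>z\<in>A. F z) = (\<Sum>k<n. of_bool (x k \<in> A) * F (x k))"
proof -
  have "A = x ` {k \<in> {..<n}. x k \<in> A}"
    using assms by (auto elim!: below_family[OF assms(1)])
  then have "(\<Sum>z\<in>A. F z) = (\<Sum>z\<in>x ` {k \<in> {..<n}. x k \<in> A}. F z)"
    by simp
  also have "\<dots> = (\<Sum>k\<in>{k \<in> {..<n}. x k \<in> A}. F (x k))"
    by (subst sum.reindex) (auto intro: inj_on_subset[OF inj])
  also have "\<dots> = (\<Sum>k<n. of_bool (x k \<in> A) * F (x k))"
    by (rule sum.mono_neutral_cong_left) auto
  finally show ?thesis .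
qed

lemma moebius_zeta:
  assumes "i < n" "j < n"
  shows "(\<Sum>k<n. moebius (x i) (x k) * of_bool (x k \<le> x j)) = of_bool (i = j)"
proof -
  have "(\<Sum>k<n. moebius (x i) (x k) * of_bool (x k \<le> x j))
      = (\<Sum>k<n. of_bool (x k \<in> {x i..x j}) * moebius (x i) (x k))"
    by (intro sum.cong) (auto simp: moebius_not_le)
  also have "\<dots> = (\<Sum>z\<in>{x i..x j}. moebius (x i) z)"
    by (rule sum_below[symmetric, OF assms(2)]) auto
  also have "\<dots> = of_bool (i = j)"
    using assms inj by (auto simp: sum_moebius[OF locally_finite] inj_on_eq_iff)
  finally show ?thesis .
qed

text \<open>The recursion of \<open>moebius\<close> runs over its second argument; this is the
  counterpart for the first argument. It follows because a one-sided inverse of a square matrix is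
  two-sided.\<close>

lemma zeta_moebius:
  assumes "i < n" "j < n"
  shows "(\<Sum>k<n. of_bool (x i \<le> x k) * moebius (x k) (x j)) = of_bool (i = j)"
  using fun_inverse_commute[of n "\<lambda>i k. moebius (x i) (x k)" "\<lambda>k j. of_bool (x k \<le> x j)"]
    moebius_zeta assms by simp

lemma moebius_eq_0:
  assumes "i < n" "j < n" "j < i"
  shows "moebius (x i) (x j) = 0"
  using mono[of i j] assms by (auto intro: moebius_not_le)

text \<open>Read from the diagonal upwards, column \<open>i\<close> of the Moebius matrix starts
  with 1, and \<open>zeta_moebius\<close> expresses each further entry through the previous ones
  with coefficients 0 or -1. There are \<open>i + 1\<close> such entries, hence the index
  \<open>i + 2\<close>.\<close>

lemma sum_cmod_moebius_le_fib:
  assumes "i < n"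
  shows "(\<Sum>k<n. cmod (moebius (x k) (x i))) \<le> real (fib (i + 2))"
proof -
  define b where "b k = Re (moebius (x (i - k)) (x i))" for k
  define c :: "nat \<Rightarrow> nat \<Rightarrow> real" where "c k j = of_bool (x (i - k) \<le> x (i - j))" for k j
  have rec: "b k = - (\<Sum>j<k. c k j * b j)" if k: "0 < k" "k < Suc i" for k
  proof -
    have "0 = (\<Sum>m<n. of_bool (x (i - k) \<le> x m) * Re (moebius (x m) (x i)))"
      using arg_cong[OF zeta_moebius[of "i - k" i], of Re] assms k
      by (auto simp: of_bool_def if_distrib[of Re] if_distrib[of "\<lambda>z. z * _"] cong: if_cong)
    \<comment> \<open>Indices before \<open>i - k\<close> drop out because the numbering extends the
      order, those after \<open>i\<close> because \<open>moebius\<close> vanishes there.\<close>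
    also have "\<dots> = (\<Sum>m\<in>{i - k..i}. of_bool (x (i - k) \<le> x m) * Re (moebius (x m) (x i)))"
    proof (rule sum.mono_neutral_right)
      show "\<forall>m\<in>{..<n} - {i - k..i}. of_bool (x (i - k) \<le> x m) * Re (moebius (x m) (x i)) = 0"
        using mono[of "i - k"] moebius_eq_0[of _ i] assms by auto
    qed (use assms in auto)
    also have "\<dots> = (\<Sum>j<Suc k. c k j * b j)"
      by (rule sum.reindex_bij_witness[of _ "\<lambda>j. i - j" "\<lambda>m. i - m"])
        (use k in \<open>auto simp: b_def c_def\<close>)
    \<comment> \<open>The summand \<open>j = k\<close> is \<open>b k\<close> itself, as
      \<open>c k k = 1\<close>; solving for it gives the recursion.\<close>
    finally show ?thesis by (simp add: c_def)
  qed
  have "(\<Sum>k<n. cmod (moebius (x k) (x i))) = (\<Sum>k<Suc i. cmod (moebius (x k) (x i)))"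
    by (rule sum.mono_neutral_right) (use assms moebius_eq_0[of _ i] in auto)
  also have "\<dots> = (\<Sum>j<Suc i. \<bar>b j\<bar>)"
    by (rule sum.reindex_bij_witness[of _ "\<lambda>j. i - j" "\<lambda>m. i - m"])
      (auto simp: b_def in_Reals_norm moebius_in_Reals)
  also have "\<dots> \<le> real (fib (Suc i + 1))"
    by (rule sum_abs_le_fib[where c = c, OF _ rec]) (auto simp: b_def c_def)
  finally show ?thesis by simp
qed

lemma sum_sum_cmod_moebius_le_fib:
  "(\<Sum>i<n. \<Sum>k<n. cmod (moebius (x k) (x i))) \<le> real (fib (n + 3)) - 2"
  unfolding sum_fib[symmetric] by (intro sum_mono sum_cmod_moebius_le_fib) auto

end

section \<open>The values of \<open>Delta\<close> and the factorization of meet matrices\<close>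

text \<open>The numbering extends the order and the family is lower closed, so \<open>x i\<close> is
  the only \<open>z\<close> in the outer sum of \<open>Delta\<close>. What remains is a sum over the
  ideal below \<open>x i\<close>.\<close>

lemma Delta_lower_closed:
  fixes x :: "nat \<Rightarrow> 'a::order_bot"
  assumes "lower_closed_family x n" "i < n"
  shows "Delta x i h = (\<Sum>k<n. h (x k) * moebius (x k) (x i))"
proof -
  interpret lower_closed_family x n by fact
  have "{z. z \<le> x i \<and> (\<forall>j<i. \<not> z \<le> x j)} = {x i}"
  proof safe
    fix z assume z: "z \<le> x i" "\<forall>j<i. \<not> z \<le> x j"
    obtain k where k: "k < n" "z = x k"
      using below_family[OF assms(2) z(1)] .
    then have "k = i"
      using z mono[of k i] assms(2) by (auto simp: le_less)
    then show "z = x i" using k by simp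
  next
    fix j assume "j < i" "x i \<le> x j"
    then show False using mono[of i j] assms(2) by auto
  qed
  then have "Delta x i h = (\<Sum>w\<in>{..x i}. h w * moebius w (x i))"
    by (simp add: Delta_def convolution_incidence_of_moebius)
  also have "\<dots> = (\<Sum>k<n. of_bool (x k \<in> {..x i}) * (h (x k) * moebius (x k) (x i)))"
    by (rule sum_below[OF assms(2)]) auto
  also have "\<dots> = (\<Sum>k<n. h (x k) * moebius (x k) (x i))"
    by (intro sum.cong) (auto simp: moebius_not_le)
  finally show ?thesis .
qed

text \<open>Moebius inversion: \<open>x k\<close> is below both \<open>x i\<close> and
  \<open>x j\<close> exactly when it is below their meet, which is some \<open>x q\<close> by lower
  closedness. After the sums are exchanged, \<open>moebius_zeta\<close> leaves only the summand at
  \<open>q\<close>.\<close>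

lemma meet_factorization:
  fixes x :: "nat \<Rightarrow> 'a::bounded_lattice_bot"
  assumes "lower_closed_family x n" "i < n" "j < n"
  shows "h (inf (x i) (x j)) = (\<Sum>k<n. Delta x k h * of_bool (x k \<le> x i) * of_bool (x k \<le> x j))"
proof -
  interpret lower_closed_family x n by fact
  obtain q where q: "q < n" "inf (x i) (x j) = x q"
    using below_family[OF assms(2), of "inf (x i) (x j)"] by auto
  have "(\<Sum>k<n. Delta x k h * of_bool (x k \<le> x i) * of_bool (x k \<le> x j))
      = (\<Sum>k<n. \<Sum>m<n. h (x m) * (moebius (x m) (x k) * of_bool (x k \<le> x q)))"
    by (intro sum.cong)
      (simp_all add: Delta_lower_closed[OF assms(1)] sum_distrib_right flip: q(2))
  also have "\<dots> = (\<Sum>m<n. h (x m) * (\<Sum>k<n. moebius (x m) (x k) * of_bool (x k \<le> x q)))"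
    by (subst sum.swap) (simp only: sum_distrib_left)
  also have "\<dots> = (\<Sum>m<n. h (x m) * of_bool (m = q))"
    using q(1) by (intro sum.cong refl arg_cong2[of _ _ _ _ "(*)"] moebius_zeta) auto
  also have "\<dots> = h (inf (x i) (x j))"
    using q by (simp add: of_bool_def if_distrib cong: if_cong)
  finally show ?thesis ..
qed

section \<open>The transformed eigenvalue problem\<close>

text \<open>The new coordinates are \<open>u = Z w\<close>, where \<open>w\<close> is the
  eigenvector \<open>v\<close> scaled entrywise by \<open>f\<close>. In them one side of the pencil
  is diagonal, as \<open>Gershgorin\<close> expects.\<close>

lemma admissible_eigenvector:
  fixes f :: "'a::bounded_lattice_bot \<Rightarrow> complex"
  assumes fam: "lower_closed_family x n"
    and semi: "semimultiplicative f" and nz: "\<And>y. f y \<noteq> 0"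
    and adm: "admissible n x f lam"
  obtains u where "\<exists>k<n. u k \<noteq> 0"
    and "\<And>p. p < n \<Longrightarrow>
      (\<Sum>k<n. (\<Sum>\<alpha><n. \<Sum>\<beta><n.
          moebius (x \<alpha>) (x p) * moebius (x \<beta>) (x k) / f (sup (x \<alpha>) (x \<beta>))) * u k)
        = lam * Delta x p (\<lambda>y. 1 / f y) * u p"
proof -
  interpret lower_closed_family x n by fact
  define g where "g = (\<lambda>y. 1 / f y)"
  define l where "l k = Delta x k g" for k
  define B where "B p k = (\<Sum>\<alpha><n. \<Sum>\<beta><n.
    moebius (x \<alpha>) (x p) * moebius (x \<beta>) (x k) / f (sup (x \<alpha>) (x \<beta>)))" for p k
  obtain v where v: "v \<in> carrier_vec n" "v \<noteq> 0\<^sub>v n"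
    and eq: "meet_matrix n x f *\<^sub>v v = lam \<cdot>\<^sub>v (join_matrix n x f *\<^sub>v v)"
    using adm by (auto simp: admissible_def)
  define w where "w j = f (x j) * v $ j" for j
  define u where "u k = (\<Sum>j<n. of_bool (x k \<le> x j) * w j)" for k
  have w: "w j = (\<Sum>k<n. moebius (x j) (x k) * u k)" if "j < n" for j
  proof -
    have "(\<Sum>k<n. moebius (x j) (x k) * u k)
        = (\<Sum>k<n. \<Sum>m<n. (moebius (x j) (x k) * of_bool (x k \<le> x m)) * w m)"
      by (simp only: u_def sum_distrib_left mult.assoc)
    also have "\<dots> = (\<Sum>m<n. (\<Sum>k<n. moebius (x j) (x k) * of_bool (x k \<le> x m)) * w m)"
      by (subst sum.swap) (simp only: sum_distrib_right)
    also have "\<dots> = (\<Sum>m<n. of_bool (j = m) * w m)"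
      using that by (intro sum.cong refl arg_cong2[of _ _ _ _ "(*)"] moebius_zeta) auto
    finally show ?thesis
      using that by (simp add: of_bool_def if_distrib[of "\<lambda>z. z * _"] cong: if_cong)
  qed
  have row: "(\<Sum>j<n. g (sup (x i) (x j)) * w j) = lam * (\<Sum>k<n. l k * of_bool (x k \<le> x i) * u k)"
    if i: "i < n" for i
  proof -
    have prod: "f (inf y z) * f (sup y z) = f y * f z" for y z
      using semi by (simp add: semimultiplicative_def)
    \<comment> \<open>Semimultiplicativity exchanges meet and join at the price of passing from
      \<open>f\<close> to \<open>g\<close>. The factor \<open>f (x i)\<close> is common to row
      \<open>i\<close> and cancels; \<open>f (x j)\<close> is absorbed into
      \<open>w j\<close>.\<close>
    have inf: "f (inf y z) = f y * (g (sup y z) * f z)"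
      and sup: "f (sup y z) = f y * (g (inf y z) * f z)" for y z
      using prod[of y z] nz by (simp_all add: g_def field_simps)
    have "(\<Sum>j<n. f (inf (x i) (x j)) * v $ j) = lam * (\<Sum>j<n. f (sup (x i) (x j)) * v $ j)"
      using arg_cong[OF eq, of "\<lambda>z. z $ i"] v(1) i
      by (simp add: meet_matrix_def join_matrix_def scalar_prod_def atLeast0LessThan)
    then have "f (x i) * (\<Sum>j<n. g (sup (x i) (x j)) * w j)
        = f (x i) * (lam * (\<Sum>j<n. g (inf (x i) (x j)) * w j))"
      unfolding inf sup w_def by (simp add: sum_distrib_left mult_ac)
    then have "(\<Sum>j<n. g (sup (x i) (x j)) * w j) = lam * (\<Sum>j<n. g (inf (x i) (x j)) * w j)"
      using nz by simp
    also have "(\<Sum>j<n. g (inf (x i) (x j)) * w j)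
        = (\<Sum>j<n. \<Sum>k<n. l k * of_bool (x k \<le> x i) * of_bool (x k \<le> x j) * w j)"
    proof (intro sum.cong refl)
      fix j assume "j \<in> {..<n}"
      then show "g (inf (x i) (x j)) * w j
          = (\<Sum>k<n. l k * of_bool (x k \<le> x i) * of_bool (x k \<le> x j) * w j)"
        using meet_factorization[OF fam i, of j g] unfolding l_def
        by (simp only: lessThan_iff sum_distrib_right)
    qed
    also have "\<dots> = (\<Sum>k<n. l k * of_bool (x k \<le> x i) * u k)"
      by (subst sum.swap) (simp only: u_def sum_distrib_left mult.assoc)
    finally show ?thesis .
  qed
  \<comment> \<open>The identity \<open>row\<close> is multiplied by the transposed Moebius matrix.
    On the left, writing \<open>w\<close> in terms of \<open>u\<close> produces \<open>B\<close>; on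
    the right, \<open>zeta_moebius\<close> isolates the summand \<open>k = p\<close>.\<close>
  have eig: "(\<Sum>k<n. B p k * u k) = lam * l p * u p" if p: "p < n" for p
  proof -
    have "(\<Sum>k<n. B p k * u k)
      = (\<Sum>k<n. \<Sum>\<alpha><n. \<Sum>\<beta><n.
        moebius (x \<alpha>) (x p) * (g (sup (x \<alpha>) (x \<beta>)) * (moebius (x \<beta>) (x k) * u k)))"
      by (simp add: B_def sum_distrib_right g_def mult.assoc)
    also have "\<dots> = (\<Sum>\<alpha><n. \<Sum>k<n. \<Sum>\<beta><n.
        moebius (x \<alpha>) (x p) * (g (sup (x \<alpha>) (x \<beta>)) * (moebius (x \<beta>) (x k) * u k)))"
      by (rule sum.swap)
    also have "\<dots> = (\<Sum>\<alpha><n. \<Sum>\<beta><n. \<Sum>k<n.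
        moebius (x \<alpha>) (x p) * (g (sup (x \<alpha>) (x \<beta>)) * (moebius (x \<beta>) (x k) * u k)))"
      by (intro sum.cong refl sum.swap)
    also have "\<dots> = (\<Sum>\<alpha><n. moebius (x \<alpha>) (x p) * (\<Sum>\<beta><n. g (sup (x \<alpha>) (x \<beta>)) * w \<beta>))"
      by (intro sum.cong refl) (simp add: w sum_distrib_left)
    also have "\<dots> = (\<Sum>\<alpha><n. \<Sum>k<n. lam * l k * u k * (of_bool (x k \<le> x \<alpha>) * moebius (x \<alpha>) (x p)))"
      by (intro sum.cong refl) (simp only: lessThan_iff row, simp only: sum_distrib_left mult_ac)
    also have "\<dots> = (\<Sum>k<n. lam * l k * u k * (\<Sum>\<alpha><n. of_bool (x k \<le> x \<alpha>) * moebius (x \<alpha>) (x p)))"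
      by (subst sum.swap) (simp only: sum_distrib_left)
    also have "\<dots> = (\<Sum>k<n. lam * l k * u k * of_bool (k = p))"
      by (intro sum.cong refl) (simp only: lessThan_iff zeta_moebius p)
    also have "\<dots> = lam * l p * u p"
      using p by (simp add: of_bool_def if_distrib cong: if_cong)
    finally show ?thesis .
  qed
  \<comment> \<open>Since \<open>w\<close> is linear in \<open>u\<close> and \<open>f\<close> has no
    zero, \<open>u = 0\<close> would force \<open>v = 0\<close>.\<close>
  have "\<exists>k<n. u k \<noteq> 0"
  proof (rule ccontr)
    assume "\<not> (\<exists>k<n. u k \<noteq> 0)"
    then have "w j = 0" if "j < n" for j
      using w[OF that] by simp
    then have "v $ j = 0" if "j < n" for j
      using nz that by (auto simp: w_def)
    then have "v = 0\<^sub>v n"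
      using v(1) by (intro eq_vecI) auto
    then show False using v(2) by simp
  qed
  then show ?thesis
    using that eig unfolding B_def l_def g_def by blast
qed

section \<open>Disks and Fibonacci bound for the admissible values\<close>

theorem theorem2:
  fixes f g :: "'a::bounded_lattice_bot \<Rightarrow> complex"
    and S :: "'a set" and x :: "nat \<Rightarrow> 'a" and n :: nat
    and l :: "nat \<Rightarrow> complex" and c\<^sub>f m\<^sub>g :: real
  assumes "locally_finite TYPE('a)"
    and "semimultiplicative f"
    and "\<And>y. f y \<noteq> 0"
    and "\<And>y. g y = 1 / f y"
    and "S = x ` {..<n}"
    and "lower_closed S"
    and "\<And>i j. i < n \<Longrightarrow> j < n \<Longrightarrow> x i \<le> x j \<Longrightarrow> i \<le> j"
    and "\<And>i. i < n \<Longrightarrow> l i = Delta x i g"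
    and "\<And>i. i < n \<Longrightarrow> l i \<noteq> 0"
    and "c\<^sub>f = Min {cmod (f (sup (x i) (x j))) | i j. i < n \<and> j < n}"
    and "m\<^sub>g = Min {cmod (Delta x i g) | i. i < n}"
  shows "(\<forall>lam. admissible n x f lam \<longrightarrow>
           (\<exists>i<n. lam \<in> {z.
              cmod (z - inverse (l i) * (\<Sum>\<alpha><n. \<Sum>\<beta><n.
                moebius (x \<alpha>) (x i) * moebius (x \<beta>) (x i) / f (sup (x \<alpha>) (x \<beta>))))
              \<le> inverse (cmod (l i)) * (\<Sum>j\<in>{..<n} - {i}. cmod (\<Sum>\<alpha><n. \<Sum>\<beta><n.
                moebius (x \<alpha>) (x i) * moebius (x \<beta>) (x j) / f (sup (x \<alpha>) (x \<beta>))))}))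
       \<and> (\<forall>lam. admissible n x f lam \<longrightarrow>
           cmod lam \<le> inverse c\<^sub>f * inverse m\<^sub>g
             * real (fib (n + 1)) * (real (fib (n + 3)) - 2))"
proof (rule conjI; intro allI impI)
  fix lam assume adm: "admissible n x f lam"
  have fam: "lower_closed_family x n"
    using assms by unfold_locales auto
  interpret lower_closed_family x n by fact
  have "g = (\<lambda>y. 1 / f y)"
    using assms(4) by (intro ext)
  then have l: "l i = Delta x i (\<lambda>y. 1 / f y)" if "i < n" for i
    using assms(8)[OF that] by simp
  define B where "B p k = (\<Sum>\<alpha><n. \<Sum>\<beta><n.
    moebius (x \<alpha>) (x p) * moebius (x \<beta>) (x k) / f (sup (x \<alpha>) (x \<beta>)))" for p k
  obtain u where u: "\<exists>k<n. u k \<noteq> 0"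
    and eig: "\<And>p. p < n \<Longrightarrow> (\<Sum>k<n. B p k * u k) = lam * l p * u p"
    using admissible_eigenvector[OF fam assms(2,3) adm, folded B_def] by (simp only: l) blast
  obtain p where p: "p < n"
    and disk: "cmod (lam * l p - B p p) \<le> (\<Sum>k\<in>{..<n} - {p}. cmod (B p k))"
    using Gershgorin[OF eig u] by blast
  have lp: "l p \<noteq> 0" using assms(9) p by simp
  {
    have "lam - inverse (l p) * B p p = inverse (l p) * (lam * l p - B p p)"
      using lp by (simp add: field_simps)
    then have "cmod (lam - inverse (l p) * B p p) = inverse (cmod (l p)) * cmod (lam * l p - B p p)"
      by (simp only: norm_mult norm_inverse)
    also have "\<dots> \<le> inverse (cmod (l p)) * (\<Sum>k\<in>{..<n} - {p}. cmod (B p k))"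
      by (intro mult_left_mono disk) simp
    finally show "\<exists>i<n. lam \<in> {z.
              cmod (z - inverse (l i) * (\<Sum>\<alpha><n. \<Sum>\<beta><n.
                moebius (x \<alpha>) (x i) * moebius (x \<beta>) (x i) / f (sup (x \<alpha>) (x \<beta>))))
              \<le> inverse (cmod (l i)) * (\<Sum>j\<in>{..<n} - {i}. cmod (\<Sum>\<alpha><n. \<Sum>\<beta><n.
                moebius (x \<alpha>) (x i) * moebius (x \<beta>) (x j) / f (sup (x \<alpha>) (x \<beta>))))}"
      using p unfolding B_def by blast
  }
  {
    \<comment> \<open>The index \<open>p\<close> shows that \<open>n > 0\<close>, so both minima are
      attained, and hence positive.\<close>
    let ?C = "{cmod (f (sup (x i) (x j))) | i j. i < n \<and> j < n}"
    have "?C = (\<lambda>(i, j). cmod (f (sup (x i) (x j)))) ` ({..<n} \<times> {..<n})"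
      by auto
    then have finC: "finite ?C" by simp
    have "c\<^sub>f \<in> ?C"
      unfolding assms(10) using p by (intro Min_in finC) auto
    then have c_pos: "c\<^sub>f > 0" using assms(3) by auto
    have c_le: "c\<^sub>f \<le> cmod (f (sup (x i) (x j)))" if "i < n" "j < n" for i j
      unfolding assms(10) using that by (intro Min_le finC) auto
    let ?M = "{cmod (Delta x i g) | i. i < n}"
    have finM: "finite ?M" by simp
    have "m\<^sub>g \<in> ?M"
      unfolding assms(11) using p by (intro Min_in finM) auto
    then have m_pos: "m\<^sub>g > 0" using assms(8,9) by fastforce
    have m_le: "m\<^sub>g \<le> cmod (l p)"
      unfolding assms(11) using p assms(8) by (intro Min_le finM) auto
    \<comment> \<open>Once each \<open>1 / f\<close> is bounded in modulus by
      \<open>inverse c\<^sub>f\<close>, the double sum splits into a product of two column sums of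
      the Moebius matrix.\<close>
    have B_le: "cmod (B p k) \<le> inverse c\<^sub>f * (\<Sum>\<alpha><n. cmod (moebius (x \<alpha>) (x p)))
        * (\<Sum>\<beta><n. cmod (moebius (x \<beta>) (x k)))" for k
    proof -
      have "cmod (B p k) \<le> (\<Sum>\<alpha><n. \<Sum>\<beta><n.
          cmod (moebius (x \<alpha>) (x p)) * cmod (moebius (x \<beta>) (x k)) * inverse c\<^sub>f)"
        unfolding B_def
        by (intro sum_norm_le)
          (auto simp: norm_mult norm_divide norm_inverse divide_inverse
            intro!: mult_left_mono le_imp_inverse_le c_le c_pos)
      also have "\<dots> = inverse c\<^sub>f * (\<Sum>\<alpha><n. cmod (moebius (x \<alpha>) (x p)))
          * (\<Sum>\<beta><n. cmod (moebius (x \<beta>) (x k)))"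
        by (simp add: sum_product sum_distrib_left sum_distrib_right mult_ac)
      finally show ?thesis .
    qed
    \<comment> \<open>By the triangle inequality, the undivided disk bounds \<open>lam * l p\<close>
      by the absolute sum of the whole row \<open>p\<close> of \<open>B\<close>, diagonal entry
      included.\<close>
    have "m\<^sub>g * cmod lam \<le> cmod (lam * l p)"
      using m_le by (simp add: norm_mult mult.commute[of "cmod lam"] mult_right_mono)
    also have "\<dots> \<le> cmod (B p p) + cmod (lam * l p - B p p)"
      using norm_triangle_ineq[of "B p p" "lam * l p - B p p"] by simp
    also have "\<dots> \<le> (\<Sum>k<n. cmod (B p k))"
      using disk p by (simp add: sum.remove[of "{..<n}" p])
    also have "\<dots> \<le> (\<Sum>k<n. inverse c\<^sub>f * (\<Sum>\<alpha><n. cmod (moebius (x \<alpha>) (x p)))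
        * (\<Sum>\<beta><n. cmod (moebius (x \<beta>) (x k))))"
      by (intro sum_mono B_le)
    also have "\<dots> = inverse c\<^sub>f * (\<Sum>\<alpha><n. cmod (moebius (x \<alpha>) (x p)))
        * (\<Sum>k<n. \<Sum>\<beta><n. cmod (moebius (x \<beta>) (x k)))"
      by (simp add: sum_distrib_left)
    also have "\<dots> \<le> inverse c\<^sub>f * real (fib (n + 1)) * (real (fib (n + 3)) - 2)"
    proof (intro mult_mono sum_sum_cmod_moebius_le_fib)
      \<comment> \<open>Only column \<open>p\<close> enters the first factor, and
        \<open>p < n\<close> gives \<open>p + 2 <= n + 1\<close>. The second factor collects all
        columns.\<close>
      have "fib (p + 2) \<le> fib (n + 1)"
        using p by (intro fib_mono) simp
      then show "(\<Sum>\<alpha><n. cmod (moebius (x \<alpha>) (x p))) \<le> real (fib (n + 1))"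
        using sum_cmod_moebius_le_fib[OF p] by linarith
    qed (use c_pos in \<open>auto intro!: sum_nonneg mult_nonneg_nonneg\<close>)
    finally show "cmod lam \<le> inverse c\<^sub>f * inverse m\<^sub>g
             * real (fib (n + 1)) * (real (fib (n + 3)) - 2)"
      using m_pos c_pos by (simp add: field_simps)
  }
qed

end
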